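(* Let $\phi=(\phi_t)_{t\in\mathbb R}$ be a flow on a compact metric space $X$, and let $X^*=X\setminus\operatorname{Sing}(\phi)$ be its regular set. If $e(\phi)<\infty$, then $$e(\phi)=\sup_{\substack{K\subset X^*\\ K\ \mathrm{compact}}} e^{\mathrm{uc}}_{\mathrm{top}}(\phi,K).$$
   Context: A flow on a metric space $(X,d)$ is a family $\phi=(\phi_t)_{t\in\mathbb R}$ of maps $X\to X$ such that $(x,t)\mapsto\phi_t(x)$ is continuous, $\phi_0=\mathrm{id}_X$ and $\phi_{t+u}=\phi_t\circ\phi_u$ for all $t,u\in\mathbb R$. Its singular set is $\operatorname{Sing}(\phi)=\{x\in X:\phi_t(x)=x\text{ for every }t\in\mathbb R\}$. $e(\phi):=h_{\mathrm{top}}(\phi_1)$ is the topological entropy of the time-one map. For $T>0$ put $d_T^\phi(x,y)=\max_{0\le t\le T}d(\phi_t(x),\phi_t(y))$. For a compact set $K\subset X$ and $\varepsilon>0$, a set $E\subset K$ is $(T,\varepsilon)$-separated if $d_T^\phi(x,y)>\varepsilon$ for all distinct $x,y\in E$; $s_T^\phi(K,\varepsilon)$ is the maximal cardinality of a $(T,\varepsilon)$-separated subset of $K$ (it is finite). The upper capacity entropy of $\phi$ on $K$ is $$e^{\mathrm{uc}}_{\mathrm{top}}(\phi,K)=\lim_{\varepsilon\to0}\limsup_{T\to\infty}\frac1T\log s_T^\phi(K,\varepsilon),$$ with the convention $e^{\mathrm{uc}}_{\mathrm{top}}(\phi,\varnothing)=0$. $K$ is not required to be invariant. *)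

theory Defs
  imports "HOL-Analysis.Analysis"
begin

text \<open>The metric space is a subset \<open>X\<close> of a metric-space type; \<open>\<phi> t\<close> is only constrained on \<open>X\<close>.\<close>

definition flow_on :: "'a::metric_space set \<Rightarrow> (real \<Rightarrow> 'a \<Rightarrow> 'a) \<Rightarrow> bool" where
  "flow_on X \<phi> \<longleftrightarrow>
     (\<forall>t. \<phi> t \<in> X \<rightarrow> X) \<and>
     continuous_on (X \<times> UNIV) (\<lambda>(x, t). \<phi> t x) \<and>
     (\<forall>x\<in>X. \<phi> 0 x = x) \<and>
     (\<forall>t u. \<forall>x\<in>X. \<phi> (t + u) x = \<phi> t (\<phi> u x))"

definition Sing :: "'a set \<Rightarrow> (real \<Rightarrow> 'a \<Rightarrow> 'a) \<Rightarrow> 'a set" where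
  "Sing X \<phi> = {x\<in>X. \<forall>t. \<phi> t x = x}"

text \<open>The maximum exists for the distance functions and compact sets used below, since there
  the cardinalities of separated sets are bounded.\<close>

definition max_separated :: "('a \<Rightarrow> 'a \<Rightarrow> real) \<Rightarrow> 'a set \<Rightarrow> real \<Rightarrow> nat" where
  "max_separated \<rho> K \<epsilon> =
     Max (card ` {E. finite E \<and> E \<subseteq> K \<and> pairwise (\<lambda>x y. \<rho> x y > \<epsilon>) E})"

text \<open>Topological entropy of a continuous self-map of a compact set \<open>X\<close>, in Bowen's form. The
  maximum is meaningful for \<open>n \<ge> 1\<close>, which is all that the upper limit sees.\<close>

definition map_dist :: "('a::metric_space \<Rightarrow> 'a) \<Rightarrow> nat \<Rightarrow> 'a \<Rightarrow> 'a \<Rightarrow> real" where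
  "map_dist f n x y = (MAX i\<in>{..<n}. dist ((f ^^ i) x) ((f ^^ i) y))"

definition h_top :: "'a::metric_space set \<Rightarrow> ('a \<Rightarrow> 'a) \<Rightarrow> ereal" where
  "h_top X f =
     (if X = {} then 0
      else Lim (at_right 0) (\<lambda>\<epsilon>. limsup (\<lambda>n.
        ereal (1 / real n * ln (real (max_separated (map_dist f n) X \<epsilon>))))))"

definition flow_entropy :: "'a::metric_space set \<Rightarrow> (real \<Rightarrow> 'a \<Rightarrow> 'a) \<Rightarrow> ereal" where
  "flow_entropy X \<phi> = h_top X (\<phi> 1)"

text \<open>For \<open>x, y \<in> X\<close> the supremum is attained, by continuity of the flow.\<close>

definition flow_dist :: "(real \<Rightarrow> 'a::metric_space \<Rightarrow> 'a) \<Rightarrow> real \<Rightarrow> 'a \<Rightarrow> 'a \<Rightarrow> real" where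
  "flow_dist \<phi> T x y = (SUP t\<in>{0..T}. dist (\<phi> t x) (\<phi> t y))"

definition upper_capacity_entropy ::
  "(real \<Rightarrow> 'a::metric_space \<Rightarrow> 'a) \<Rightarrow> 'a set \<Rightarrow> ereal" where
  "upper_capacity_entropy \<phi> K =
     (if K = {} then 0
      else Lim (at_right 0) (\<lambda>\<epsilon>. Limsup at_top (\<lambda>T.
        ereal (1 / T * ln (real (max_separated (flow_dist \<phi> T) K \<epsilon>))))))"

end

theory Submission imports Defs "HOL-Real_Asymp.Real_Asymp" begin

text \<open>Near the singular set the flow is slow: on an \<open>\<eta>\<close>-neighbourhood \<open>U\<close> of \<open>Sing X \<phi>\<close> no point
  moves by \<open>\<epsilon>/4\<close> or more during a long time \<open>M\<close>.  Given an \<open>(n, \<epsilon>)\<close>-separated set \<open>E\<close>, record for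
  \<open>x \<in> E\<close> the first integer time \<open>a\<close> at which the orbit meets \<open>K = X - U\<close>, and the position of the orbit
  with respect to a finite net \<open>P\<close> at the multiples of \<open>M\<close>.  Points with the same record stay
  \<open>\<epsilon>\<close>-close before time \<open>a\<close>, so \<open>\<phi> a\<close> sends them injectively to a separated subset of \<open>K\<close>.
  As there are at most \<open>(n + 1) |P|\<^bsup>n/M + 1\<^esup>\<close> records, passing from \<open>X\<close> to \<open>K\<close> loses at
  most \<open>ln |P| / M\<close> of exponential growth at scale \<open>\<epsilon>\<close>, where \<open>P\<close> depends only on \<open>\<epsilon>\<close>.\<close>

section \<open>Limits as the scale tends to zero\<close>

text \<open>Growth rates of separated sets increase as the scale shrinks, so the limits defining
  both entropies are suprema: an upper bound may be proved scale by scale, and any single scale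
  gives a lower bound.\<close>

lemma Lim_at_right_antimono:
  fixes f :: "real \<Rightarrow> ereal"
  assumes "\<And>x y. 0 < x \<Longrightarrow> x \<le> y \<Longrightarrow> f y \<le> f x"
  shows "Lim (at_right 0) f = (SUP x\<in>{0<..}. f x)"
proof (rule tendsto_Lim)
  show "(f \<longlongrightarrow> (SUP x\<in>{0<..}. f x)) (at_right 0)"
  proof (rule order_tendstoI)
    fix a assume "a < (SUP x\<in>{0<..}. f x)"
    then obtain d where d: "d > 0" "a < f d"
      by (auto simp: less_SUP_iff)
    have "a < f x" if "0 < x" "x < d" for x
      using d assms[of x d] that by (auto intro: less_le_trans)
    with d show "\<forall>\<^sub>F x in at_right 0. a < f x"
      by (auto simp: eventually_at_right_field)
  next
    fix a assume "(SUP x\<in>{0<..}. f x) < a"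
    then have "f x < a" if "0 < x" for x
      using that by (meson SUP_upper greaterThan_iff le_less_trans)
    then show "\<forall>\<^sub>F x in at_right 0. f x < a"
      by (auto simp: eventually_at_right_field intro!: exI[of _ 1])
  qed
qed simp

section \<open>Separated sets, fibre counting and finite nets\<close>

abbreviation separated_in :: "('a \<Rightarrow> 'a \<Rightarrow> real) \<Rightarrow> 'a set \<Rightarrow> real \<Rightarrow> 'a set \<Rightarrow> bool" where
  "separated_in \<rho> K \<epsilon> E \<equiv> finite E \<and> E \<subseteq> K \<and> pairwise (\<lambda>x y. \<rho> x y > \<epsilon>) E"

lemma separated_in_antimono:
  "separated_in \<rho> K \<epsilon> E \<Longrightarrow> \<delta> \<le> \<epsilon> \<Longrightarrow> separated_in \<rho> K \<delta> E"
  unfolding pairwise_def using le_less_trans by blast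

lemma separated_inD:
  "separated_in \<rho> K \<epsilon> E \<Longrightarrow> x \<in> E \<Longrightarrow> y \<in> E \<Longrightarrow> x \<noteq> y \<Longrightarrow> \<epsilon> < \<rho> x y"
  by (simp add: pairwise_def)

text \<open>The uniform bound makes the set of cardinalities finite and the empty separated set
  makes it nonempty, so \<open>Max\<close> is a genuine maximum.\<close>

lemma max_separated_le:
  assumes "\<And>E. separated_in \<rho> K \<epsilon> E \<Longrightarrow> card E \<le> N"
  shows "max_separated \<rho> K \<epsilon> \<le> N"
proof -
  have sub: "card ` {E. separated_in \<rho> K \<epsilon> E} \<subseteq> {..N}"
    using assms by auto
  have ne: "{} \<in> {E. separated_in \<rho> K \<epsilon> E}"
    by (auto simp: pairwise_def)
  show ?thesis
    unfolding max_separated_def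
  proof (rule Max.boundedI)
    show "finite (card ` {E. separated_in \<rho> K \<epsilon> E})"
      using sub finite_subset by blast
  qed (use sub ne in auto)
qed

text \<open>The number \<open>N\<close> serves only to make the set of cardinalities finite; its
  value does not enter the conclusion.\<close>

lemma card_le_max_separated:
  assumes "\<And>E. separated_in \<rho> K \<epsilon> E \<Longrightarrow> card E \<le> N" and "separated_in \<rho> K \<epsilon> E"
  shows "card E \<le> max_separated \<rho> K \<epsilon>"
proof -
  have "card ` {E. separated_in \<rho> K \<epsilon> E} \<subseteq> {..N}"
    using assms(1) by auto
  then have "finite (card ` {E. separated_in \<rho> K \<epsilon> E})"
    using finite_subset by blast
  then show ?thesis
    unfolding max_separated_def using assms(2) by (auto intro!: Max_ge)
qed

lemma card_le_fibres:
  assumes "finite E" "finite C" "f ` E \<subseteq> C" "\<And>c. c \<in> C \<Longrightarrow> card {x\<in>E. f x = c} \<le> b"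
  shows "card E \<le> card C * b"
proof -
  have "E = (\<Union>c\<in>C. {x\<in>E. f x = c})"
    using assms(3) by auto
  then have "card E \<le> (\<Sum>c\<in>C. card {x\<in>E. f x = c})"
    using card_UN_le[OF assms(2), of "\<lambda>c. {x\<in>E. f x = c}"] by simp
  also have "\<dots> \<le> card C * b"
    using sum_bounded_above[of C "\<lambda>c. card {x\<in>E. f x = c}" b] assms(4) by simp
  finally show ?thesis .
qed

lemma map_dist_gt_iff:
  assumes "n > 0"
  shows "map_dist f n x y > \<epsilon> \<longleftrightarrow> (\<exists>i<n. dist ((f ^^ i) x) ((f ^^ i) y) > \<epsilon>)"
  using assms unfolding map_dist_def by (subst Max_gr_iff) auto

lemma compact_finite_net:
  fixes X :: "'a::metric_space set"
  assumes "compact X" "d > 0"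
  obtains P where "finite P" "\<And>x. x \<in> X \<Longrightarrow> \<exists>p\<in>P. dist p x < d"
proof -
  obtain P where "finite P" "X \<subseteq> (\<Union>p\<in>P. ball p d)"
    using assms unfolding compact_eq_totally_bounded by blast
  then show ?thesis
    using that[of P] by (auto simp: subset_iff)
qed

text \<open>Two points assigned to the same point of a net of mesh \<open>d / 2\<close> are less
  than \<open>d\<close> apart, hence not separated. So a separated set injects into the net.\<close>

lemma separated_card_bound:
  fixes X :: "'a::metric_space set"
  assumes "compact X" "K \<subseteq> X" "d > 0"
    and "\<And>x y. x \<in> X \<Longrightarrow> y \<in> X \<Longrightarrow> dist x y < d \<Longrightarrow> \<rho> x y \<le> \<epsilon>"
  obtains N where "\<And>E. separated_in \<rho> K \<epsilon> E \<Longrightarrow> card E \<le> N"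
proof -
  obtain P where P: "finite P" "\<And>x. x \<in> X \<Longrightarrow> \<exists>p\<in>P. dist p x < d / 2"
    using compact_finite_net[of X "d / 2"] assms by auto
  obtain g where g: "\<And>x. x \<in> X \<Longrightarrow> g x \<in> P \<and> dist (g x) x < d / 2"
    using P(2) by metis
  have "card E \<le> card P" if E: "separated_in \<rho> K \<epsilon> E" for E
  proof (rule card_inj_on_le[of g])
    show "inj_on g E"
    proof (rule inj_onI, rule ccontr)
      fix x y assume xy: "x \<in> E" "y \<in> E" "g x = g y" "x \<noteq> y"
      then have X: "x \<in> X" "y \<in> X"
        using E assms(2) by auto
      have "dist x y < d"
        using g[OF X(1)] g[OF X(2)] xy(3) dist_triangle_half_r by metis
      with assms(4) X have "\<rho> x y \<le> \<epsilon>" by blast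
      moreover have "\<rho> x y > \<epsilon>"
        using E xy by (auto simp: pairwise_def)
      ultimately show False by simp
    qed
  qed (use E assms(2) g P in auto)
  then show ?thesis
    by (rule that)
qed

section \<open>Distances and separated sets for a flow on a compact space\<close>

locale compact_flow =
  fixes X :: "'a::metric_space set" and \<phi> :: "real \<Rightarrow> 'a \<Rightarrow> 'a"
  assumes compact_X: "compact X" and flow: "flow_on X \<phi>"
begin

lemma flow_in: "x \<in> X \<Longrightarrow> \<phi> t x \<in> X"
  using flow by (auto simp: flow_on_def)

lemma flow_zero: "x \<in> X \<Longrightarrow> \<phi> 0 x = x"
  using flow by (auto simp: flow_on_def)

lemma flow_add: "x \<in> X \<Longrightarrow> \<phi> (t + u) x = \<phi> t (\<phi> u x)"
  using flow by (auto simp: flow_on_def)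

lemma funpow_flow: "x \<in> X \<Longrightarrow> (\<phi> 1 ^^ i) x = \<phi> (real i) x"
proof (induction i)
  case (Suc i)
  then show ?case
    using flow_add[of x 1 "real i"] by simp
qed (simp add: flow_zero)

text \<open>The flow is jointly continuous, hence uniformly continuous on the compact set
  \<open>X \<times> {0..T}\<close>; the claim compares pairs with equal time coordinate.\<close>

lemma flow_uniform:
  assumes "e > 0"
  obtains d where "d > 0"
    "\<And>x y t. x \<in> X \<Longrightarrow> y \<in> X \<Longrightarrow> dist x y < d \<Longrightarrow> t \<in> {0..T} \<Longrightarrow> dist (\<phi> t x) (\<phi> t y) < e"
proof -
  have "continuous_on (X \<times> {0..T}) (\<lambda>(x, t). \<phi> t x)"
    using flow unfolding flow_on_def by (auto intro: continuous_on_subset)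
  then have "uniformly_continuous_on (X \<times> {0..T}) (\<lambda>(x, t). \<phi> t x)"
    by (intro compact_uniformly_continuous compact_Times compact_X) auto
  then obtain d where d: "d > 0"
    and dd: "\<And>p q. p \<in> X \<times> {0..T} \<Longrightarrow> q \<in> X \<times> {0..T} \<Longrightarrow> dist q p < d \<Longrightarrow>
      dist (case q of (x, t) \<Rightarrow> \<phi> t x) (case p of (x, t) \<Rightarrow> \<phi> t x) < e"
    using uniformly_continuous_onE[OF _ assms] by blast
  have "dist (\<phi> t x) (\<phi> t y) < e"
    if "x \<in> X" "y \<in> X" "dist x y < d" "t \<in> {0..T}" for x y t
    using dd[of "(y, t)" "(x, t)"] that by (simp add: dist_Pair_Pair)
  with d show ?thesis by (rule that)
qed

text \<open>Boundedness of \<open>X\<close> makes the supremum a genuine one, and it exceeds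
  \<epsilon> exactly when some value does.\<close>

lemma flow_dist_gt_iff:
  assumes "x \<in> X" "y \<in> X" "T \<ge> 0"
  shows "flow_dist \<phi> T x y > \<epsilon> \<longleftrightarrow> (\<exists>t\<in>{0..T}. dist (\<phi> t x) (\<phi> t y) > \<epsilon>)"
proof -
  obtain B where "\<forall>u\<in>X. \<forall>v\<in>X. dist u v \<le> B"
    using compact_imp_bounded[OF compact_X] unfolding bounded_two_points by blast
  then have "bdd_above ((\<lambda>t. dist (\<phi> t x) (\<phi> t y)) ` {0..T})"
    using flow_in assms by (auto intro!: bdd_aboveI2)
  then show ?thesis
    unfolding flow_dist_def using assms by (subst less_cSUP_iff) auto
qed

lemma flow_dist_card_bound:
  assumes "K \<subseteq> X" "\<epsilon> > 0" "T \<ge> 0"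
  obtains N where "\<And>E. separated_in (flow_dist \<phi> T) K \<epsilon> E \<Longrightarrow> card E \<le> N"
proof -
  obtain d where d: "d > 0" "\<And>x y t. x \<in> X \<Longrightarrow> y \<in> X \<Longrightarrow> dist x y < d \<Longrightarrow> t \<in> {0..T} \<Longrightarrow>
      dist (\<phi> t x) (\<phi> t y) < \<epsilon>"
    using flow_uniform[OF assms(2), of T] by blast
  have "flow_dist \<phi> T x y \<le> \<epsilon>" if "x \<in> X" "y \<in> X" "dist x y < d" for x y
    using flow_dist_gt_iff[of x y T \<epsilon>] that d(2)[of x y] assms(3) by fastforce
  then show ?thesis
    using separated_card_bound[OF compact_X assms(1) d(1), of "flow_dist \<phi> T" \<epsilon>] that by blast
qed

lemma card_le_max_separated_flow:
  assumes "K \<subseteq> X" "\<epsilon> > 0" "T \<ge> 0" "separated_in (flow_dist \<phi> T) K \<epsilon> E"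
  shows "card E \<le> max_separated (flow_dist \<phi> T) K \<epsilon>"
proof -
  obtain N where N: "\<And>F. separated_in (flow_dist \<phi> T) K \<epsilon> F \<Longrightarrow> card F \<le> N"
    using flow_dist_card_bound[OF assms(1-3)] by blast
  show ?thesis
    by (rule card_le_max_separated[OF N assms(4)])
qed

lemma map_dist_flow_gt_iff:
  assumes "x \<in> X" "y \<in> X" "n > 0"
  shows "map_dist (\<phi> 1) n x y > \<epsilon> \<longleftrightarrow> (\<exists>i<n. dist (\<phi> (real i) x) (\<phi> (real i) y) > \<epsilon>)"
  using assms by (simp add: map_dist_gt_iff funpow_flow)

text \<open>The integer times below \<open>n\<close> lie in \<open>{0..n}\<close>, so a separation
  seen by the time-one map is also seen by the flow. This carries the finiteness of separated sets
  over from \<open>flow_dist\<close> to \<open>map_dist\<close>.\<close>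

lemma separated_map_imp_flow:
  assumes "K \<subseteq> X" "n > 0" "separated_in (map_dist (\<phi> 1) n) K \<epsilon> E"
  shows "separated_in (flow_dist \<phi> n) K \<epsilon> E"
proof -
  have "flow_dist \<phi> n x y > \<epsilon>" if xy: "x \<in> E" "y \<in> E" "x \<noteq> y" for x y
  proof -
    have X: "x \<in> X" "y \<in> X"
      using xy assms by auto
    obtain i where "i < n" "dist (\<phi> (real i) x) (\<phi> (real i) y) > \<epsilon>"
      using separated_inD[OF assms(3) xy] unfolding map_dist_flow_gt_iff[OF X assms(2)] by blast
    then show ?thesis
      unfolding flow_dist_gt_iff[OF X of_nat_0_le_iff] by (auto intro!: bexI[of _ "real i"])
  qed
  with assms show ?thesis
    by (auto simp: pairwise_def)
qed

lemma card_le_max_separated_map: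
  assumes "K \<subseteq> X" "\<epsilon> > 0" "n > 0" "separated_in (map_dist (\<phi> 1) n) K \<epsilon> E"
  shows "card E \<le> max_separated (map_dist (\<phi> 1) n) K \<epsilon>"
proof (rule card_le_max_separated[OF _ assms(4)])
  fix F assume "separated_in (map_dist (\<phi> 1) n) K \<epsilon> F"
  from separated_map_imp_flow[OF assms(1,3) this]
  show "card F \<le> max_separated (flow_dist \<phi> n) K \<epsilon>"
    by (rule card_le_max_separated_flow[OF assms(1,2) of_nat_0_le_iff])
qed

lemma max_separated_map_le_flow:
  assumes "K \<subseteq> X" "\<epsilon> > 0" "n > 0"
  shows "max_separated (map_dist (\<phi> 1) n) K \<epsilon> \<le> max_separated (flow_dist \<phi> n) K \<epsilon>"
proof (rule max_separated_le)
  fix F assume "separated_in (map_dist (\<phi> 1) n) K \<epsilon> F"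
  from separated_map_imp_flow[OF assms(1,3) this]
  show "card F \<le> max_separated (flow_dist \<phi> n) K \<epsilon>"
    by (rule card_le_max_separated_flow[OF assms(1,2) of_nat_0_le_iff])
qed

text \<open>A singleton is separated. Positivity is what allows \<open>ln\<close> to be applied
  monotonically to these numbers.\<close>

lemma max_separated_flow_pos:
  assumes "K \<subseteq> X" "\<epsilon> > 0" "T \<ge> 0" "K \<noteq> {}"
  shows "max_separated (flow_dist \<phi> T) K \<epsilon> > 0"
proof -
  obtain x where "x \<in> K" using assms by blast
  then have "separated_in (flow_dist \<phi> T) K \<epsilon> {x}"
    by (auto simp: pairwise_def)
  from card_le_max_separated_flow[OF assms(1-3) this] show ?thesis by simp
qed

lemma max_separated_map_pos:
  assumes "K \<subseteq> X" "\<epsilon> > 0" "n > 0" "K \<noteq> {}"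
  shows "max_separated (map_dist (\<phi> 1) n) K \<epsilon> > 0"
proof -
  obtain x where "x \<in> K" using assms by blast
  then have "separated_in (map_dist (\<phi> 1) n) K \<epsilon> {x}"
    by (auto simp: pairwise_def)
  from card_le_max_separated_map[OF assms(1-3) this] show ?thesis by simp
qed

lemma max_separated_flow_antimono:
  assumes "K \<subseteq> X" "0 < \<delta>" "\<delta> \<le> \<epsilon>" "T \<ge> 0"
  shows "max_separated (flow_dist \<phi> T) K \<epsilon> \<le> max_separated (flow_dist \<phi> T) K \<delta>"
proof (rule max_separated_le)
  fix E assume "separated_in (flow_dist \<phi> T) K \<epsilon> E"
  from separated_in_antimono[OF this assms(3)]
  show "card E \<le> max_separated (flow_dist \<phi> T) K \<delta>"
    by (rule card_le_max_separated_flow[OF assms(1,2,4)])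
qed

lemma max_separated_map_antimono:
  assumes "K \<subseteq> X" "0 < \<delta>" "\<delta> \<le> \<epsilon>" "n > 0"
  shows "max_separated (map_dist (\<phi> 1) n) K \<epsilon> \<le> max_separated (map_dist (\<phi> 1) n) K \<delta>"
proof (rule max_separated_le)
  fix E assume "separated_in (map_dist (\<phi> 1) n) K \<epsilon> E"
  from separated_in_antimono[OF this assms(3)]
  show "card E \<le> max_separated (map_dist (\<phi> 1) n) K \<delta>"
    by (rule card_le_max_separated_map[OF assms(1,2,4)])
qed

section \<open>Entropies as suprema over scales\<close>

lemma flow_entropy_eq_SUP:
  assumes "X \<noteq> {}"
  shows "flow_entropy X \<phi> = (SUP \<epsilon>\<in>{0<..}. limsup (\<lambda>n.
    ereal (1 / real n * ln (real (max_separated (map_dist (\<phi> 1) n) X \<epsilon>)))))"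
proof -
  have "limsup (\<lambda>n. ereal (1 / real n * ln (real (max_separated (map_dist (\<phi> 1) n) X \<epsilon>))))
      \<le> limsup (\<lambda>n. ereal (1 / real n * ln (real (max_separated (map_dist (\<phi> 1) n) X \<delta>))))"
    if "0 < \<delta>" "\<delta> \<le> \<epsilon>" for \<delta> \<epsilon>
  proof (rule Limsup_mono, rule eventually_mono[OF eventually_gt_at_top[of 0]])
    fix n :: nat assume "n > 0"
    then show "ereal (1 / real n * ln (real (max_separated (map_dist (\<phi> 1) n) X \<epsilon>)))
      \<le> ereal (1 / real n * ln (real (max_separated (map_dist (\<phi> 1) n) X \<delta>)))"
      using max_separated_map_antimono[of X \<delta> \<epsilon> n] max_separated_map_pos[of X \<epsilon> n] that assms
      by (auto intro!: mult_left_mono divide_right_mono)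
  qed
  then show ?thesis
    using assms unfolding flow_entropy_def h_top_def by (simp add: Lim_at_right_antimono)
qed

text \<open>This settles the empty compact set, whose upper capacity entropy is 0 by
  convention.\<close>

lemma flow_entropy_nonneg: "0 \<le> flow_entropy X \<phi>"
proof (cases "X = {}")
  case True
  then show ?thesis
    by (simp add: flow_entropy_def h_top_def)
next
  case False
  have "\<forall>\<^sub>F n in sequentially. 0 \<le> ereal (1 / real n * ln (real (max_separated (map_dist (\<phi> 1) n) X 1)))"
    using eventually_gt_at_top[of 0]
  proof eventually_elim
    case (elim n)
    then show ?case
      using max_separated_map_pos[of X 1 n] False by simp
  qed
  then have "0 \<le> limsup (\<lambda>n. ereal (1 / real n * ln (real (max_separated (map_dist (\<phi> 1) n) X 1))))"
    by (intro le_Limsup) auto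
  also have "\<dots> \<le> flow_entropy X \<phi>"
    unfolding flow_entropy_eq_SUP[OF False] by (intro SUP_upper) auto
  finally show ?thesis .
qed

lemma upper_capacity_entropy_eq_SUP:
  assumes "K \<subseteq> X" "K \<noteq> {}"
  shows "upper_capacity_entropy \<phi> K = (SUP \<epsilon>\<in>{0<..}. Limsup at_top (\<lambda>T.
    ereal (1 / T * ln (real (max_separated (flow_dist \<phi> T) K \<epsilon>)))))"
proof -
  have "Limsup at_top (\<lambda>T. ereal (1 / T * ln (real (max_separated (flow_dist \<phi> T) K \<epsilon>))))
      \<le> Limsup at_top (\<lambda>T. ereal (1 / T * ln (real (max_separated (flow_dist \<phi> T) K \<delta>))))"
    if "0 < \<delta>" "\<delta> \<le> \<epsilon>" for \<delta> \<epsilon>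
  proof (rule Limsup_mono, rule eventually_mono[OF eventually_gt_at_top[of 0]])
    fix T :: real assume "T > 0"
    then show "ereal (1 / T * ln (real (max_separated (flow_dist \<phi> T) K \<epsilon>)))
      \<le> ereal (1 / T * ln (real (max_separated (flow_dist \<phi> T) K \<delta>)))"
      using max_separated_flow_antimono[of K \<delta> \<epsilon> T] max_separated_flow_pos[of K \<epsilon> T] that assms
      by (auto intro!: mult_left_mono divide_right_mono)
  qed
  then show ?thesis
    using assms unfolding upper_capacity_entropy_def by (simp add: Lim_at_right_antimono)
qed

section \<open>Upper capacity entropy is at most the entropy of the flow\<close>

text \<open>Flowing for a time in \<open>{0..1}\<close> keeps \<open>d\<close>-close points
  \<epsilon>-close. Hence orbits more than \<epsilon> apart at time \<open>t\<close> are at least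
  \<open>d\<close> apart at the integer time \<lfloor>t\<rfloor>. The scale obtained depends on
  \<epsilon> alone, not on \<open>K\<close> or \<open>T\<close>.\<close>

lemma max_separated_flow_le_map:
  assumes "\<epsilon> > 0"
  obtains \<delta> where "\<delta> > 0" "\<And>K T. K \<subseteq> X \<Longrightarrow> T \<ge> 0 \<Longrightarrow>
    max_separated (flow_dist \<phi> T) K \<epsilon> \<le> max_separated (map_dist (\<phi> 1) (Suc (nat \<lfloor>T\<rfloor>))) X \<delta>"
proof -
  obtain d where d: "d > 0" "\<And>x y t. x \<in> X \<Longrightarrow> y \<in> X \<Longrightarrow> dist x y < d \<Longrightarrow> t \<in> {0..1} \<Longrightarrow>
      dist (\<phi> t x) (\<phi> t y) < \<epsilon>"
    using flow_uniform[OF assms, of 1] by blast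
  \<comment> \<open>Halving \<open>d\<close> turns "at least \<open>d\<close>" into the strict
    inequality of separation; the successor is there because the integer times run from 0 to
    \<lfloor>T\<rfloor> inclusive.\<close>
  have "max_separated (flow_dist \<phi> T) K \<epsilon> \<le> max_separated (map_dist (\<phi> 1) (Suc (nat \<lfloor>T\<rfloor>))) X (d/2)"
    if "K \<subseteq> X" "T \<ge> 0" for K T
  proof (rule max_separated_le)
    fix E assume E: "separated_in (flow_dist \<phi> T) K \<epsilon> E"
    have "map_dist (\<phi> 1) (Suc (nat \<lfloor>T\<rfloor>)) x y > d / 2" if xy: "x \<in> E" "y \<in> E" "x \<noteq> y" for x y
    proof -
      have X: "x \<in> X" "y \<in> X"
        using xy E \<open>K \<subseteq> X\<close> by auto
      obtain t where t: "t \<in> {0..T}" "dist (\<phi> t x) (\<phi> t y) > \<epsilon>"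
        using separated_inD[OF E xy] unfolding flow_dist_gt_iff[OF X \<open>T \<ge> 0\<close>] by blast
      define i where "i = nat \<lfloor>t\<rfloor>"
      have i: "i < Suc (nat \<lfloor>T\<rfloor>)" "t - real i \<in> {0..1}"
        using t(1) by (auto simp: i_def less_Suc_eq_le nat_mono floor_mono) linarith
      have "\<phi> t z = \<phi> (t - real i) (\<phi> (real i) z)" if "z \<in> X" for z
        using flow_add[OF that, of "t - real i" "real i"] by simp
      then have "\<not> dist (\<phi> (real i) x) (\<phi> (real i) y) < d"
        using d(2)[OF flow_in[OF X(1)] flow_in[OF X(2)] _ i(2)] t(2) X by force
      then show ?thesis
        unfolding map_dist_flow_gt_iff[OF X zero_less_Suc] using i(1) \<open>d > 0\<close>
        by (auto intro!: exI[of _ i])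
    qed
    then have "separated_in (map_dist (\<phi> 1) (Suc (nat \<lfloor>T\<rfloor>))) X (d/2) E"
      using E \<open>K \<subseteq> X\<close> by (auto simp: pairwise_def)
    then show "card E \<le> max_separated (map_dist (\<phi> 1) (Suc (nat \<lfloor>T\<rfloor>))) X (d/2)"
      using card_le_max_separated_map[of X] \<open>d > 0\<close> by simp
  qed
  then show ?thesis
    using that[of "d/2"] \<open>d > 0\<close> by simp
qed

lemma upper_capacity_entropy_le:
  assumes "K \<subseteq> X" "K \<noteq> {}"
  shows "upper_capacity_entropy \<phi> K \<le> flow_entropy X \<phi>"
proof (rule ereal_le_real)
  \<comment> \<open>Real upper bounds \<open>c\<close> of the entropy suffice; if the entropy is
    infinite there are none and the claim is vacuous.\<close>
  fix c :: real assume "flow_entropy X \<phi> \<le> ereal c"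
  have "X \<noteq> {}" using assms by blast
  have "Limsup at_top (\<lambda>T. ereal (1 / T * ln (real (max_separated (flow_dist \<phi> T) K \<epsilon>)))) \<le> ereal c"
    if "\<epsilon> > 0" for \<epsilon>
  proof (rule ereal_le_epsilon2)
    fix e :: real assume "e > 0"
    obtain \<delta> where \<delta>: "\<delta> > 0" "\<And>T. T \<ge> 0 \<Longrightarrow>
      max_separated (flow_dist \<phi> T) K \<epsilon> \<le> max_separated (map_dist (\<phi> 1) (Suc (nat \<lfloor>T\<rfloor>))) X \<delta>"
      using max_separated_flow_le_map[OF \<open>\<epsilon> > 0\<close>] assms(1) by metis
    define s where "s n = max_separated (map_dist (\<phi> 1) n) X \<delta>" for n
    have "limsup (\<lambda>n. ereal (1 / real n * ln (real (s n)))) \<le> flow_entropy X \<phi>"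
      unfolding flow_entropy_eq_SUP[OF \<open>X \<noteq> {}\<close>] s_def using \<open>\<delta> > 0\<close> by (intro SUP_upper) auto
    also have "\<dots> < ereal (c + e)"
      using \<open>flow_entropy X \<phi> \<le> ereal c\<close> \<open>e > 0\<close> by (simp add: le_less_trans)
    finally have "\<forall>\<^sub>F n in sequentially. ereal (1 / real n * ln (real (s n))) < ereal (c + e)"
      by (rule Limsup_lessD)
    then obtain n0 where n0: "\<And>n. n \<ge> n0 \<Longrightarrow> 1 / real n * ln (real (s n)) < c + e"
      by (auto simp: eventually_sequentially)
    have "1 / T * ln (real (max_separated (flow_dist \<phi> T) K \<epsilon>)) \<le> (c + e) * real (Suc (nat \<lfloor>T\<rfloor>)) / T"
      if "T \<ge> max 1 (real n0)" for T
    proof -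
      define n where "n = Suc (nat \<lfloor>T\<rfloor>)"
      have n: "n > 0" "n \<ge> n0" "T > 0"
        using that by (auto simp: n_def le_nat_floor le_SucI)
      have "ln (real (max_separated (flow_dist \<phi> T) K \<epsilon>)) \<le> ln (real (s n))"
        using \<delta>(2)[of T] max_separated_flow_pos[of K \<epsilon> T] assms \<open>\<epsilon> > 0\<close> n
        by (simp add: s_def n_def)
      also have "\<dots> \<le> (c + e) * real n"
        using n0[OF n(2)] n(1) by (simp add: field_simps)
      finally show ?thesis
        using n(3) by (simp add: field_simps n_def)
    qed
    then have "\<forall>\<^sub>F T in at_top. ereal (1 / T * ln (real (max_separated (flow_dist \<phi> T) K \<epsilon>)))
        \<le> ereal ((c + e) * real (Suc (nat \<lfloor>T\<rfloor>)) / T)"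
      unfolding eventually_at_top_linorder by (metis ereal_less_eq(3))
    then have "Limsup at_top (\<lambda>T. ereal (1 / T * ln (real (max_separated (flow_dist \<phi> T) K \<epsilon>))))
        \<le> Limsup at_top (\<lambda>T. ereal ((c + e) * real (Suc (nat \<lfloor>T\<rfloor>)) / T))"
      by (rule Limsup_mono)
    \<comment> \<open>Rounding to integer time costs nothing in the limit, since
      (\<lfloor>T\<rfloor> + 1) / T tends to 1.\<close>
    also have "\<dots> = ereal (c + e)"
    proof (rule lim_imp_Limsup)
      have lim: "((\<lambda>T::real. (c + e) * ((of_int \<lfloor>T\<rfloor> + 1) / T)) \<longlongrightarrow> (c + e) * 1) at_top"
        by (intro tendsto_mult tendsto_const) real_asymp
      have ev: "\<forall>\<^sub>F T::real in at_top. (c + e) * ((of_int \<lfloor>T\<rfloor> + 1) / T)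
          = (c + e) * real (Suc (nat \<lfloor>T\<rfloor>)) / T"
        using eventually_ge_at_top[of 0] by eventually_elim simp
      show "((\<lambda>T. ereal ((c + e) * real (Suc (nat \<lfloor>T\<rfloor>)) / T)) \<longlongrightarrow> ereal (c + e)) at_top"
        using Lim_transform_eventually[OF lim ev] by simp
    qed simp
    finally show "Limsup at_top (\<lambda>T. ereal (1 / T * ln (real (max_separated (flow_dist \<phi> T) K \<epsilon>))))
        \<le> ereal c + ereal e"
      by simp
  qed
  then show "upper_capacity_entropy \<phi> K \<le> ereal c"
    unfolding upper_capacity_entropy_eq_SUP[OF assms] by (intro SUP_least) auto
qed

section \<open>Slow motion near the singular set and counting of records\<close>

text \<open>If \<open>x\<close> is close to a singular point \<open>s\<close>, then
  \<open>\<phi> t x\<close> is within \<delta>/2 of \<open>\<phi> t s = s\<close>, which is itself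
  within \<delta>/2 of \<open>x\<close>.\<close>

lemma slow_near_Sing:
  assumes "\<delta> > 0"
  obtains \<eta> where "\<eta> > 0" "\<And>x t. x \<in> X \<Longrightarrow> x \<in> (\<Union>s\<in>Sing X \<phi>. ball s \<eta>) \<Longrightarrow> t \<in> {0..M} \<Longrightarrow>
    dist (\<phi> t x) x < \<delta>"
proof -
  obtain d where d: "d > 0" "\<And>x y t. x \<in> X \<Longrightarrow> y \<in> X \<Longrightarrow> dist x y < d \<Longrightarrow> t \<in> {0..M} \<Longrightarrow>
      dist (\<phi> t x) (\<phi> t y) < \<delta> / 2"
    using flow_uniform[of "\<delta> / 2" M] assms by auto
  have "dist (\<phi> t x) x < \<delta>"
    if "x \<in> X" "t \<in> {0..M}" "s \<in> Sing X \<phi>" "dist s x < min d (\<delta> / 2)" for x t s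
  proof -
    have s: "s \<in> X" "\<phi> t s = s"
      using that(3) by (auto simp: Sing_def)
    then have "dist (\<phi> t x) s < \<delta> / 2"
      using d(2)[of x s t] that by (simp add: dist_commute)
    then show ?thesis
      using that(4) dist_triangle_half_r[of s "\<phi> t x" \<delta> x] by (simp add: dist_commute)
  qed
  then show ?thesis
    using that[of "min d (\<delta> / 2)"] d(1) assms by auto
qed

text \<open>The factors count entry times, codes, and points sharing both. The \<open>max 1\<close>
  covers orbits that do not enter \<open>K\<close> before time \<open>n\<close>, of which each code
  admits at most one.\<close>

lemma card_separated_le:
  fixes M :: nat
  assumes "\<epsilon> > 0" "M > 0" "n > 0" "K \<subseteq> X"
    and slow: "\<And>x t. x \<in> X - K \<Longrightarrow> t \<in> {0..real M} \<Longrightarrow> dist (\<phi> t x) x < \<epsilon> / 4"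
    and P: "finite P" "\<And>x. x \<in> X \<Longrightarrow> \<exists>p\<in>P. dist p x < \<epsilon> / 4"
  shows "max_separated (map_dist (\<phi> 1) n) X \<epsilon>
    \<le> Suc n * card P ^ Suc (n div M) * max 1 (max_separated (map_dist (\<phi> 1) n) K \<epsilon>)"
proof (rule max_separated_le)
  fix E assume E: "separated_in (map_dist (\<phi> 1) n) X \<epsilon> E"
  obtain g where g: "\<And>x. x \<in> X \<Longrightarrow> g x \<in> P \<and> dist (g x) x < \<epsilon> / 4"
    using P(2) by metis
  \<comment> \<open>The disjunct \<open>i = n\<close> makes the least element exist; the value
    \<open>n\<close> means that no integer time below \<open>n\<close> lies in
    \<open>K\<close>.\<close>
  define a where "a x = (LEAST i. i = n \<or> \<phi> (real i) x \<in> K)" for x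
  \<comment> \<open>Restriction to \<open>{..n div M}\<close> makes codes extensional, so that they
    lie in a finite \<open>PiE\<close> set.\<close>
  define code where "code x = (\<lambda>k\<in>{..n div M}. g (\<phi> (real (k * M)) x))" for x
  have a_le: "a x \<le> n" for x
    unfolding a_def by (rule Least_le) simp
  have a_K: "a x = n \<or> \<phi> (real (a x)) x \<in> K" for x
    unfolding a_def by (rule LeastI[of _ n]) simp
  have before_a: "\<phi> (real i) x \<notin> K" if "i < a x" for i x
    using that not_less_Least unfolding a_def by blast
  have near: "dist (\<phi> (real i) x) (code x (i div M)) < \<epsilon> / 2" if "x \<in> X" "i < a x" for x i
  proof -
    \<comment> \<open>The last multiple of \<open>M\<close> up to \<open>i\<close>. The orbit is
      still outside \<open>K\<close> then and moves less than \<epsilon>/4 until time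
      \<open>i\<close>; the net point adds another \<epsilon>/4.\<close>
    define j where "j = i div M * M"
    have "j \<le> i" "i - j < M"
      using \<open>M > 0\<close> by (auto simp: j_def minus_div_mult_eq_mod)
    have "i div M \<le> n div M"
      using that(2) a_le[of x] by (intro div_le_mono) simp
    have "\<phi> (real i) x = \<phi> (real (i - j)) (\<phi> (real j) x)"
      using flow_add[OF that(1), of "real (i - j)" "real j"] \<open>j \<le> i\<close> by (simp add: of_nat_diff)
    moreover have "dist (\<phi> (real (i - j)) (\<phi> (real j) x)) (\<phi> (real j) x) < \<epsilon> / 4"
      using before_a[of j x] that \<open>j \<le> i\<close> \<open>i - j < M\<close> flow_in[OF that(1)] by (intro slow) auto
    moreover have "dist (code x (i div M)) (\<phi> (real j) x) < \<epsilon> / 4"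
      using g[OF flow_in[OF that(1)]] \<open>i div M \<le> n div M\<close> by (simp add: code_def j_def)
    ultimately show ?thesis
      using dist_triangle2[of "\<phi> (real i) x" "code x (i div M)" "\<phi> (real j) x"] by simp
  qed
  let ?C = "{..n} \<times> ({..n div M} \<rightarrow>\<^sub>E P)"
  let ?b = "max 1 (max_separated (map_dist (\<phi> 1) n) K \<epsilon>)"
  have "card E \<le> card ?C * ?b"
  proof (rule card_le_fibres[of E ?C "\<lambda>x. (a x, code x)"])
    show "(\<lambda>x. (a x, code x)) ` E \<subseteq> ?C"
    proof (clarsimp simp: a_le)
      fix x assume "x \<in> E"
      then have "x \<in> X" using E by auto
      then show "code x \<in> {..n div M} \<rightarrow>\<^sub>E P"
        unfolding code_def using g flow_in by auto
    qed
    fix c assume "c \<in> ?C"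
    obtain m h where c: "c = (m, h)" by fastforce
    define F where "F = {x\<in>E. (a x, code x) = c}"
    have F: "F \<subseteq> X" "F \<subseteq> E" "finite F"
      using E by (auto simp: F_def)
    \<comment> \<open>Before time \<open>m\<close> both orbits stay within \<epsilon>/2 of a common
      net point, so they can only separate from \<open>m\<close> on.\<close>
    have late: "\<exists>i<n. m \<le> i \<and> dist (\<phi> (real i) x) (\<phi> (real i) y) > \<epsilon>"
      if xy: "x \<in> F" "y \<in> F" "x \<noteq> y" for x y
    proof -
      have X: "x \<in> X" "y \<in> X"
        using F xy by auto
      obtain i where i: "i < n" "dist (\<phi> (real i) x) (\<phi> (real i) y) > \<epsilon>"
        using separated_inD[OF E, of x y] xy F(2) map_dist_flow_gt_iff[OF X \<open>n > 0\<close>] by blast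
      have "m \<le> i"
      proof (rule ccontr)
        assume "\<not> m \<le> i"
        then have "i < a x" "i < a y" "code x = code y"
          using xy by (auto simp: F_def c)
        then show False
          using near[of x i] near[of y i] X i(2)
            dist_triangle_half_l[of "\<phi> (real i) x" "code x (i div M)" \<epsilon> "\<phi> (real i) y"]
          by simp
      qed
      with i show ?thesis by blast
    qed
    show "card {x\<in>E. (a x, code x) = c} \<le> ?b"
    proof (cases "m = n")
      \<comment> \<open>No time \<open>i\<close> with \<open>m \<le> i < n\<close> remains, so the
        fibre has at most one point.\<close>
      case True
      then have "x = y" if "x \<in> F" "y \<in> F" for x y
        using late[of x y] that by fastforce
      then have "card F \<le> 1"
        using F(3) by (simp add: card_le_Suc0_iff_eq)
      then show ?thesis
        by (simp add: F_def)
    next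
      case False
      \<comment> \<open>The shifted time \<open>i - m\<close> is still below \<open>n\<close>, so
        the images are separated for the same \<open>n\<close> and orbit lengths need not be tracked
        per fibre.\<close>
      have shift: "\<exists>i<n. dist (\<phi> (real i) (\<phi> (real m) x)) (\<phi> (real i) (\<phi> (real m) y)) > \<epsilon>"
        if "x \<in> F" "y \<in> F" "x \<noteq> y" for x y
      proof -
        obtain i where i: "i < n" "m \<le> i" "dist (\<phi> (real i) x) (\<phi> (real i) y) > \<epsilon>"
          using late[OF \<open>x \<in> F\<close> \<open>y \<in> F\<close> \<open>x \<noteq> y\<close>] by blast
        have "\<phi> (real (i - m)) (\<phi> (real m) z) = \<phi> (real i) z" if "z \<in> X" for z
          using flow_add[OF that, of "real (i - m)" "real m"] i(2) by (simp add: of_nat_diff)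
        then show ?thesis
          using i F that by (intro exI[of _ "i - m"]) (auto simp: subset_iff)
      qed
      have inj: "inj_on (\<phi> (real m)) F"
      proof (rule inj_onI, rule ccontr)
        fix x y assume "x \<in> F" "y \<in> F" "\<phi> (real m) x = \<phi> (real m) y" "x \<noteq> y"
        then show False
          using shift[of x y] \<open>\<epsilon> > 0\<close> by auto
      qed
      have "separated_in (map_dist (\<phi> 1) n) K \<epsilon> (\<phi> (real m) ` F)"
      proof (intro conjI)
        show "finite (\<phi> (real m) ` F)" using F by simp
        show "\<phi> (real m) ` F \<subseteq> K"
          using a_K False by (auto simp: F_def c)
        show "pairwise (\<lambda>x y. \<epsilon> < map_dist (\<phi> 1) n x y) (\<phi> (real m) ` F)"
        proof (rule pairwise_imageI)
          fix x y assume xy: "x \<in> F" "y \<in> F" "x \<noteq> y"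
          then have "x \<in> X" "y \<in> X" using F by auto
          then show "\<epsilon> < map_dist (\<phi> 1) n (\<phi> (real m) x) (\<phi> (real m) y)"
            using shift[OF xy] map_dist_flow_gt_iff[OF flow_in flow_in \<open>n > 0\<close>] by blast
        qed
      qed
      then have "card (\<phi> (real m) ` F) \<le> max_separated (map_dist (\<phi> 1) n) K \<epsilon>"
        using card_le_max_separated_map assms by blast
      then show ?thesis
        using inj by (simp add: card_image F_def)
    qed
  qed (use E P in \<open>auto intro: finite_PiE\<close>)
  also have "card ?C = Suc n * card P ^ Suc (n div M)"
    by (simp add: card_cartesian_product card_PiE)
  finally show "card E \<le> Suc n * card P ^ Suc (n div M) * ?b" .
qed

section \<open>Bounding the entropy by compact regular subsets\<close>

lemma flow_entropy_le:
  assumes "X \<noteq> {}" and B: "(SUP K\<in>{K. K \<subseteq> X - Sing X \<phi> \<and> compact K}. upper_capacity_entropy \<phi> K) < ereal B"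
  shows "flow_entropy X \<phi> \<le> ereal B"
proof -
  let ?S = "SUP K\<in>{K. K \<subseteq> X - Sing X \<phi> \<and> compact K}. upper_capacity_entropy \<phi> K"
  \<comment> \<open>The empty compact set forces \<open>B\<close> to be positive, which handles the
    case \<open>K = {}\<close> below.\<close>
  have "upper_capacity_entropy \<phi> {} \<le> ?S"
    by (rule SUP_upper) auto
  then have "0 < B"
    using B by (simp add: upper_capacity_entropy_def flip: ereal_less(2))
  have "limsup (\<lambda>n. ereal (1 / real n * ln (real (max_separated (map_dist (\<phi> 1) n) X \<epsilon>)))) \<le> ereal B"
    if "\<epsilon> > 0" for \<epsilon>
  proof (rule ereal_le_epsilon2)
    fix e :: real assume "e > 0"
    obtain P where P: "finite P" "\<And>x. x \<in> X \<Longrightarrow> \<exists>p\<in>P. dist p x < \<epsilon> / 4"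
      using compact_finite_net[OF compact_X, of "\<epsilon> / 4"] \<open>\<epsilon> > 0\<close> by auto
    then have "card P > 0"
      using \<open>X \<noteq> {}\<close> by (auto simp: card_gt_0_iff)
    define p where "p = ln (real (card P))"
    have "p \<ge> 0"
      using \<open>card P > 0\<close> by (simp add: p_def)
    \<comment> \<open>The net depends only on \<epsilon>, so \<open>p\<close> is already fixed and
      the block length can be chosen to make the cost of the codes, \<open>p / M\<close> per unit
      time, smaller than \<open>e\<close>.\<close>
    obtain M where M: "M > 0" "p / real M < e"
    proof -
      obtain M where "p / e < real M"
        using reals_Archimedean2 by blast
      moreover have "0 \<le> p / e"
        using \<open>p \<ge> 0\<close> \<open>e > 0\<close> by simp
      ultimately have "M > 0"
        by (cases "M = 0") auto
      with \<open>p / e < real M\<close> \<open>e > 0\<close> show ?thesis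
        by (intro that[of M]) (auto simp: field_simps)
    qed
    obtain \<eta> where \<eta>: "\<eta> > 0" "\<And>x t. x \<in> X \<Longrightarrow> x \<in> (\<Union>s\<in>Sing X \<phi>. ball s \<eta>) \<Longrightarrow>
        t \<in> {0..real M} \<Longrightarrow> dist (\<phi> t x) x < \<epsilon> / 4"
      using slow_near_Sing[of "\<epsilon> / 4" "real M"] \<open>\<epsilon> > 0\<close> by auto
    \<comment> \<open>An open neighbourhood is removed, so \<open>K\<close> is compact; every
      singular point is the centre of a removed ball.\<close>
    define K where "K = X - (\<Union>s\<in>Sing X \<phi>. ball s \<eta>)"
    have K: "K \<subseteq> X" "K \<subseteq> X - Sing X \<phi>" "compact K"
      using \<open>\<eta> > 0\<close> compact_X by (auto simp: K_def intro!: compact_diff)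
    define s where "s n = max_separated (map_dist (\<phi> 1) n) K \<epsilon>" for n
    have sB: "\<forall>\<^sub>F n in sequentially. ln (real (max 1 (s n))) \<le> B * real n"
    proof (cases "K = {}")
      case True
      then have "s n \<le> 0" for n
        unfolding s_def by (intro max_separated_le) auto
      then show ?thesis
        using \<open>0 < B\<close> by (simp add: max_def)
    next
      case False
      have "Limsup at_top (\<lambda>T. ereal (1 / T * ln (real (max_separated (flow_dist \<phi> T) K \<epsilon>))))
          \<le> upper_capacity_entropy \<phi> K"
        unfolding upper_capacity_entropy_eq_SUP[OF K(1) False] using \<open>\<epsilon> > 0\<close>
        by (intro SUP_upper) auto
      also have "\<dots> \<le> ?S"
        using K by (intro SUP_upper) auto
      finally have "\<forall>\<^sub>F T in at_top.
          ereal (1 / T * ln (real (max_separated (flow_dist \<phi> T) K \<epsilon>))) < ereal B"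
        using B by (intro Limsup_lessD) simp
      \<comment> \<open>A bound for all large real times is restricted to integer times.\<close>
      then have "\<forall>\<^sub>F n in sequentially.
          1 / real n * ln (real (max_separated (flow_dist \<phi> (real n)) K \<epsilon>)) < B"
        using filterlim_real_sequentially by (auto simp: filterlim_iff)
      then show ?thesis
        using eventually_gt_at_top[of 0]
      proof eventually_elim
        case (elim n)
        have "s n > 0" "s n \<le> max_separated (flow_dist \<phi> (real n)) K \<epsilon>"
          using max_separated_map_pos max_separated_map_le_flow elim(2) K(1) False \<open>\<epsilon> > 0\<close>
          unfolding s_def by auto
        then have "ln (real (max 1 (s n))) \<le> ln (real (max_separated (flow_dist \<phi> (real n)) K \<epsilon>))"
          by (simp add: max_def)
        also have "\<dots> \<le> B * real n"
          using elim by (simp add: field_simps)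
        finally show ?case .
      qed
    qed
    \<comment> \<open>The logarithm of the counting bound divided by \<open>n\<close>: entry times,
      codes, and the growth on \<open>K\<close>, with \<open>n div M\<close> replaced by
      \<open>n / M\<close>. The limit is \<open>p / M + B\<close>.\<close>
    define r where "r n = ln (real n + 1) / real n + (real n / real M + 1) * p / real n + B" for n :: nat
    have "\<forall>\<^sub>F n in sequentially.
        ereal (1 / real n * ln (real (max_separated (map_dist (\<phi> 1) n) X \<epsilon>))) \<le> ereal (r n)"
      using sB eventually_gt_at_top[of 0]
    proof eventually_elim
      case (elim n)
      let ?m = "max_separated (map_dist (\<phi> 1) n) X \<epsilon>"
      have "?m \<le> Suc n * card P ^ Suc (n div M) * max 1 (s n)"
        unfolding s_def using \<open>\<epsilon> > 0\<close> M(1) elim(2) K(1) P \<eta>(2)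
        by (intro card_separated_le) (auto simp: K_def)
      then have "real ?m \<le> real (Suc n * card P ^ Suc (n div M) * max 1 (s n))"
        by (rule of_nat_mono)
      moreover have "?m > 0"
        using max_separated_map_pos \<open>\<epsilon> > 0\<close> elim(2) \<open>X \<noteq> {}\<close> by blast
      ultimately have "ln (real ?m) \<le> ln (real (Suc n * card P ^ Suc (n div M) * max 1 (s n)))"
        by (subst ln_le_cancel_iff) auto
      also have "\<dots> = ln (real n + 1) + real (Suc (n div M)) * p + ln (real (max 1 (s n)))"
        using \<open>card P > 0\<close> unfolding of_nat_mult of_nat_power
        by (subst ln_mult_pos, simp, simp, subst ln_mult_pos, simp, simp,
            subst ln_realpow, simp) (simp add: p_def add.commute)
      also have "\<dots> \<le> ln (real n + 1) + (real n / real M + 1) * p + B * real n"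
        using elim(1) \<open>p \<ge> 0\<close> of_nat_div_le_of_nat[of n M, where ?'a = real]
        by (intro add_mono mult_right_mono) auto
      also have "\<dots> = r n * real n"
        using elim(2) by (simp add: r_def field_simps)
      finally show ?case
        using elim(2) by (simp add: field_simps)
    qed
    then have "limsup (\<lambda>n. ereal (1 / real n * ln (real (max_separated (map_dist (\<phi> 1) n) X \<epsilon>))))
        \<le> limsup (\<lambda>n. ereal (r n))"
      by (rule Limsup_mono)
    also have "\<dots> = ereal (0 + p / real M + B)"
    proof (rule lim_imp_Limsup)
      have "(\<lambda>n. ln (real n + 1) / real n) \<longlonglongrightarrow> 0"
        by real_asymp
      moreover have "(\<lambda>n. (real n / real M + 1) * p / real n) \<longlonglongrightarrow> p / real M"
        using M(1) by real_asymp (simp add: field_simps)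
      ultimately have "r \<longlonglongrightarrow> 0 + p / real M + B"
        unfolding r_def by (intro tendsto_add tendsto_const)
      then show "(\<lambda>n. ereal (r n)) \<longlonglongrightarrow> ereal (0 + p / real M + B)"
        by simp
    qed simp
    also have "\<dots> \<le> ereal B + ereal e"
      using M(2) by simp
    finally show "limsup (\<lambda>n. ereal (1 / real n * ln (real (max_separated (map_dist (\<phi> 1) n) X \<epsilon>))))
        \<le> ereal B + ereal e" .
  qed
  then show ?thesis
    unfolding flow_entropy_eq_SUP[OF assms(1)] by (intro SUP_least) auto
qed

end

section \<open>Equality of the entropy and the supremum over compact regular sets\<close>

theorem theorem1p1:
  fixes X :: "'a::metric_space set" and \<phi> :: "real \<Rightarrow> 'a \<Rightarrow> 'a"
  assumes "compact X"
    and "flow_on X \<phi>"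
    and "flow_entropy X \<phi> < \<infinity>"
  shows "flow_entropy X \<phi> =
    (SUP K\<in>{K. K \<subseteq> X - Sing X \<phi> \<and> compact K}. upper_capacity_entropy \<phi> K)"
proof (cases "X = {}")
  case True
  then have "{K. K \<subseteq> X - Sing X \<phi> \<and> compact K} = {{}}"
    by auto
  then show ?thesis
    using True by (simp add: flow_entropy_def h_top_def upper_capacity_entropy_def)
next
  case False
  interpret compact_flow X \<phi>
    using assms by unfold_locales
  let ?S = "SUP K\<in>{K. K \<subseteq> X - Sing X \<phi> \<and> compact K}. upper_capacity_entropy \<phi> K"
  have "upper_capacity_entropy \<phi> {} \<le> ?S"
    by (rule SUP_upper) auto
  then have S: "0 \<le> ?S"
    by (simp add: upper_capacity_entropy_def)
  show ?thesis
  proof (rule antisym)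
    show "flow_entropy X \<phi> \<le> ?S"
    \<comment> \<open>By density, bounds by every \<open>z\<close> strictly above the supremum
      suffice; this supplies the real constant of \<open>flow_entropy_le\<close>, and an infinite
      \<open>z\<close> is immediate.\<close>
    proof (rule dense_ge)
      fix z assume z: "?S < z"
      show "flow_entropy X \<phi> \<le> z"
        using flow_entropy_le[OF False] z S by (cases z) auto
    qed
    show "?S \<le> flow_entropy X \<phi>"
      using upper_capacity_entropy_le flow_entropy_nonneg
      by (intro SUP_least) (auto simp: upper_capacity_entropy_def)
  qed
qed

end
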